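(* Let $f:\mathbb{R}^n\to\mathbb{R}$ and $\mathbf{M}$ be as defined in the context. For any global minimizer $\mathbf{y}\in\mathbb{R}^n$ of $f$ over $\mathbb{R}^n$, we have $\lambda_{\max}=\mathbf{y}^T\mathbf{y}$, where $\lambda_{\max}$ is the largest real eigenvalue of $\mathbf{M}$.
   Context: Setting. Let $n,m\ge 1$, let $\mathbf{s}_1,\dots,\mathbf{s}_m\in\mathbb{R}^n$ (senders), $d_1,\dots,d_m\in\mathbb{R}$ (distance measurements), and let $\mathbf{W}=(w_{ij})\in\mathbb{R}^{m\times m}$ be symmetric positive definite. Assume (normalization) that $\sum_{i,j} w_{ij}=1$ and $\sum_{i,j} w_{ij}\mathbf{s}_i=\mathbf{0}$. Define $h:\mathbb{R}^n\to\mathbb{R}$ by $$h(\mathbf{x})=\frac14\sum_{i=1}^m\sum_{j=1}^m w_{ij}\,(\|\mathbf{x}-\mathbf{s}_i\|^2-d_i^2)(\|\mathbf{x}-\mathbf{s}_j\|^2-d_j^2).$$ Then $\nabla h(\mathbf{x})=(\mathbf{x}^T\mathbf{x})\mathbf{x}-\mathbf{A}\mathbf{x}+\mathbf{g}$, where $$\mathbf{A}=-\sum_{i,j}w_{ij}\left(2\mathbf{s}_j\mathbf{s}_i^T+(\mathbf{s}_i^T\mathbf{s}_i-d_i^2)\mathbf{I}\right),\qquad \mathbf{g}=-\sum_{i,j}w_{ij}(\mathbf{s}_i^T\mathbf{s}_i-d_i^2)\mathbf{s}_j,$$ and $\mathbf{A}$ is real symmetric. Let $\mathbf{Q}$ be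 an orthogonal matrix such that $\mathbf{D}=\mathbf{Q}^T\mathbf{A}\mathbf{Q}$ is diagonal with $D_{11}\ge D_{22}\ge\dots\ge D_{nn}$, and let $\mathbf{b}=\mathbf{Q}^T\mathbf{g}$. Define $f(\mathbf{y})=h(\mathbf{Q}\mathbf{y})$ for $\mathbf{y}\in\mathbb{R}^n$, so that $$\nabla f(\mathbf{y})=(\mathbf{y}^T\mathbf{y})\mathbf{y}-\mathbf{D}\mathbf{y}+\mathbf{b}.$$ Define the $(2n+1)\times(2n+1)$ real matrix $$\mathbf{M}=\begin{pmatrix}\mathbf{D}&-\operatorname{diag}(\mathbf{b})&\mathbf{0}\\ \mathbf{O}&\mathbf{D}&-\mathbf{b}\\ \mathbf{1}^T&\mathbf{0}^T&0\end{pmatrix},$$ with block sizes $n,n,1$, where $\mathbf{O}$ is the $n\times n$ zero matrix and $\mathbf{1}\in\mathbb{R}^n$ is the all-ones vector. *)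

theory Defs
  imports "HOL-Analysis.Analysis"
begin

definition symmetric_matrix :: "real^'n^'n \<Rightarrow> bool" where
  "symmetric_matrix A \<longleftrightarrow> transpose A = A"

definition positive_definite :: "real^'n^'n \<Rightarrow> bool" where
  "positive_definite A \<longleftrightarrow> symmetric_matrix A \<and> (\<forall>v. v \<noteq> 0 \<longrightarrow> 0 < v \<bullet> (A *v v))"

definition diagonal_matrix :: "real^'n^'n \<Rightarrow> bool" where
  "diagonal_matrix A \<longleftrightarrow> (\<forall>i j. i \<noteq> j \<longrightarrow> A $ i $ j = 0)"

definition diag :: "real^'n \<Rightarrow> real^'n^'n" where
  "diag v = (\<chi> i j. if i = j then v $ i else 0)"

text \<open>The outer product \<open>u v\<^sup>T\<close>.\<close>
definition outer :: "real^'n \<Rightarrow> real^'n \<Rightarrow> real^'n^'n" where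
  "outer u v = (\<chi> k l. u $ k * v $ l)"

definition real_eigenvalue :: "real^'n^'n \<Rightarrow> real \<Rightarrow> bool" where
  "real_eigenvalue A \<mu> \<longleftrightarrow> (\<exists>v. v \<noteq> 0 \<and> A *v v = \<mu> *\<^sub>R v)"

text \<open>A real matrix need not have a real eigenvalue, so the largest one is rendered as a
  relation; it asserts existence as well as maximality.\<close>
definition is_largest_real_eigenvalue :: "real^'n^'n \<Rightarrow> real \<Rightarrow> bool" where
  "is_largest_real_eigenvalue A \<mu> \<longleftrightarrow>
     real_eigenvalue A \<mu> \<and> (\<forall>\<nu>. real_eigenvalue A \<nu> \<longrightarrow> \<nu> \<le> \<mu>)"

definition sr_objective ::
  "real^'m^'m \<Rightarrow> ('m \<Rightarrow> real^'n) \<Rightarrow> ('m \<Rightarrow> real) \<Rightarrow> real^'n \<Rightarrow> real" where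
  "sr_objective W s d x =
     1/4 * (\<Sum>i\<in>UNIV. \<Sum>j\<in>UNIV. W $ i $ j *
       ((norm (x - s i))\<^sup>2 - (d i)\<^sup>2) * ((norm (x - s j))\<^sup>2 - (d j)\<^sup>2))"

text \<open>The gradient of the objective at \<open>x\<close> is \<open>(x \<bullet> x) x - A x + g\<close>, with \<open>A\<close>
  and \<open>g\<close> as follows (under the normalization of the weights and senders).\<close>
definition sr_A ::
  "real^'m^'m \<Rightarrow> ('m \<Rightarrow> real^'n) \<Rightarrow> ('m \<Rightarrow> real) \<Rightarrow> real^'n^'n" where
  "sr_A W s d =
     - (\<Sum>i\<in>UNIV. \<Sum>j\<in>UNIV. W $ i $ j *\<^sub>R
         (2 *\<^sub>R outer (s j) (s i) + (s i \<bullet> s i - (d i)\<^sup>2) *\<^sub>R mat 1))"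

definition sr_g ::
  "real^'m^'m \<Rightarrow> ('m \<Rightarrow> real^'n) \<Rightarrow> ('m \<Rightarrow> real) \<Rightarrow> real^'n" where
  "sr_g W s d =
     - (\<Sum>i\<in>UNIV. \<Sum>j\<in>UNIV. (W $ i $ j * (s i \<bullet> s i - (d i)\<^sup>2)) *\<^sub>R s j)"

text \<open>The block matrix with rows \<open>(D, - diag b, 0)\<close>, \<open>(0, D, - b)\<close>, \<open>(1\<^sup>T, 0\<^sup>T, 0)\<close>.
  The index type \<open>'n + 'n + unit\<close> has \<open>2n + 1\<close> elements; its three summands, reached by
  \<open>Inl\<close>, \<open>Inr \<circ> Inl\<close> and \<open>Inr \<circ> Inr\<close>, index the three blocks.\<close>
definition sr_M :: "real^'n^'n \<Rightarrow> real^'n \<Rightarrow> real^('n + 'n + unit)^('n + 'n + unit)" where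
  "sr_M D b = (\<chi> r c.
     case r of
       Inl i \<Rightarrow>
         (case c of Inl j \<Rightarrow> D $ i $ j
          | Inr (Inl j) \<Rightarrow> - (diag b $ i $ j)
          | Inr (Inr _) \<Rightarrow> 0)
     | Inr (Inl i) \<Rightarrow>
         (case c of Inl j \<Rightarrow> 0
          | Inr (Inl j) \<Rightarrow> D $ i $ j
          | Inr (Inr _) \<Rightarrow> - (b $ i))
     | Inr (Inr _) \<Rightarrow>
         (case c of Inl j \<Rightarrow> 1
          | Inr (Inl j) \<Rightarrow> 0
          | Inr (Inr _) \<Rightarrow> 0))"

end

theory Submission
  imports Defs
begin

text \<open>
  Up to a constant, \<open>f y = (y \<bullet> y)\<^sup>2 / 4 - y \<bullet> D y / 2 + b \<bullet> y\<close>. Restricted to a line parallel to a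
  coordinate axis this is a quartic polynomial, and minimality of \<open>y\<close> along it, for
  \<open>\<lambda> = y \<bullet> y\<close>, gives \<open>b = (D - \<lambda>) y\<close> as well as \<open>D\<^sub>i\<^sub>i \<le> \<lambda>\<close>: the latter comes from comparing
  \<open>y\<close> with its reflection in the hyperplane \<open>y\<^sub>i = 0\<close>, or with nearby points if \<open>y\<^sub>i = 0\<close>.
  The first condition makes \<open>(y \<circ> y, y, 1)\<close> an eigenvector of \<open>M\<close> for \<open>\<lambda>\<close>, where \<open>\<circ>\<close> is the
  entrywise product. If \<open>\<nu> > \<lambda>\<close> were another
  eigenvalue, then \<open>D - \<nu>\<close> would be invertible, and eliminating the first two blocks of the
  eigenvector yields \<open>\<nu> = (\<Sum>i. b\<^sub>i\<^sup>2 / (\<nu> - D\<^sub>i\<^sub>i)\<^sup>2) \<le> (\<Sum>i. y\<^sub>i\<^sup>2) = \<lambda>\<close>.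
\<close>

section \<open>Optimality along coordinate lines\<close>

text \<open>The polynomial is the change of the objective from \<open>y\<close> to
  \<open>y + t e_i\<close>, with \<open>l = y \<bullet> y\<close>, \<open>p = y $ i\<close>,
  \<open>k = D $ i $ i\<close> and \<open>a = b $ i\<close>.\<close>

lemma quartic_min_at_zero:
  fixes a k p l :: real
  assumes nonneg: "\<And>t. 0 \<le> ((l + 2 * p * t + t\<^sup>2)\<^sup>2 - l\<^sup>2) / 4 - k * (2 * p * t + t\<^sup>2) / 2 + a * t"
  shows "a = (k - l) * p" and "k \<le> l"
proof -
  let ?q = "\<lambda>t. ((l + 2 * p * t + t\<^sup>2)\<^sup>2 - l\<^sup>2) / 4 - k * (2 * p * t + t\<^sup>2) / 2 + a * t"
  have "(?q has_real_derivative (l * p - k * p + a)) (at 0)"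
    by (auto intro!: derivative_eq_intros)
  then have "l * p - k * p + a = 0"
    by (rule DERIV_local_min[where d = 1]) (use nonneg in auto)
  then show a: "a = (k - l) * p"
    by (simp add: algebra_simps)
  show "k \<le> l"
  proof (cases "p = 0")
    case True
    show ?thesis
    proof (rule ccontr)
      assume "\<not> k \<le> l"
      \<comment> \<open>For \<open>p = 0\<close>, hence \<open>a = 0\<close>, the polynomial is
        t^4/4 - (k - l) t^2/2, which is smallest at t^2 = k - l.\<close>
      then have "(sqrt (k - l))\<^sup>2 = k - l"
        by simp
      then have "?q (sqrt (k - l)) = - (k - l)\<^sup>2 / 4"
        using True a by (simp add: power2_eq_square field_simps)
      moreover have "0 < (k - l)\<^sup>2"
        using \<open>\<not> k \<le> l\<close> by simp
      ultimately show False
        using nonneg[of "sqrt (k - l)"] by linarith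
    qed
  next
    case False
    \<comment> \<open>At t = -2p, the reflected point, \<open>2 * p * t + t\<^sup>2\<close> vanishes
      and only the linear term \<open>a * t\<close> survives.\<close>
    have "?q (- (2 * p)) = 2 * p\<^sup>2 * (l - k)"
      unfolding a by (simp add: power2_eq_square field_simps)
    then have "0 \<le> 2 * p\<^sup>2 * (l - k)"
      using nonneg[of "- (2 * p)"] by simp
    then show ?thesis
      using False by (simp add: zero_le_mult_iff)
  qed
qed

lemma diagonal_matrix_vector_mult_nth:
  assumes "diagonal_matrix D"
  shows "(D *v v) $ i = D $ i $ i * v $ i"
proof -
  have "(\<Sum>j\<in>UNIV. D $ i $ j * v $ j) = (\<Sum>j\<in>UNIV. if j = i then D $ i $ i * v $ i else 0)"
    using assms by (intro sum.cong) (auto simp: diagonal_matrix_def)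
  then show ?thesis
    by (simp add: matrix_vector_mult_def)
qed

lemma quartic_minimizer:
  fixes D :: "real^'n^'n" and b y :: "real^'n"
  assumes D: "diagonal_matrix D"
    and min: "\<And>z. (y \<bullet> y)\<^sup>2 / 4 - y \<bullet> (D *v y) / 2 + b \<bullet> y
               \<le> (z \<bullet> z)\<^sup>2 / 4 - z \<bullet> (D *v z) / 2 + b \<bullet> z"
  shows "b $ i = (D $ i $ i - y \<bullet> y) * y $ i" and "D $ i $ i \<le> y \<bullet> y"
proof -
  have nonneg: "0 \<le> ((y \<bullet> y + 2 * y $ i * t + t\<^sup>2)\<^sup>2 - (y \<bullet> y)\<^sup>2) / 4
      - D $ i $ i * (2 * y $ i * t + t\<^sup>2) / 2 + b $ i * t" for t
  proof -
    let ?e = "axis i 1 :: real^'n"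
    let ?z = "y + t *\<^sub>R ?e"
    have e: "y \<bullet> ?e = y $ i" "?e \<bullet> y = y $ i" "b \<bullet> ?e = b $ i" "?e \<bullet> ?e = 1"
      by (simp_all add: inner_axis inner_commute[of ?e])
    \<comment> \<open>The axis vector is an eigenvector of \<open>D\<close>, so along its line only
      the entry \<open>D $ i $ i\<close> enters the change of the quadratic term.\<close>
    have De: "D *v ?e = D $ i $ i *\<^sub>R ?e"
      by (simp add: vec_eq_iff diagonal_matrix_vector_mult_nth[OF D] axis_def)
    have eD: "?e \<bullet> (D *v y) = D $ i $ i * y $ i"
      by (simp add: inner_commute[of ?e] inner_axis diagonal_matrix_vector_mult_nth[OF D])
    have "?z \<bullet> ?z = y \<bullet> y + 2 * y $ i * t + t\<^sup>2"
      using e by (simp add: inner_simps power2_eq_square algebra_simps)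
    moreover have "?z \<bullet> (D *v ?z) = y \<bullet> (D *v y) + D $ i $ i * (2 * y $ i * t + t\<^sup>2)"
      using e eD by (simp add: inner_simps matrix_vector_right_distrib scaleR_matrix_vector_assoc[symmetric]
          matrix_vector_mult_scaleR De power2_eq_square algebra_simps)
    moreover have "b \<bullet> ?z = b \<bullet> y + b $ i * t"
      using e by (simp add: inner_simps)
    ultimately show ?thesis
      using min[of ?z] by (simp add: diff_divide_distrib add_divide_distrib)
  qed
  show "b $ i = (D $ i $ i - y \<bullet> y) * y $ i" "D $ i $ i \<le> y \<bullet> y"
    using quartic_min_at_zero[OF nonneg] by simp_all
qed

section \<open>Real eigenvalues of the block matrix\<close>

lemma sum_UNIV_Plus:
  fixes h :: "'a::finite + 'b::finite \<Rightarrow> 'c::comm_monoid_add"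
  shows "(\<Sum>c\<in>UNIV. h c) = (\<Sum>j\<in>UNIV. h (Inl j)) + (\<Sum>j\<in>UNIV. h (Inr j))"
  by (simp add: UNIV_Plus_UNIV[symmetric] sum.Plus del: UNIV_Plus_UNIV)

text \<open>Diagonality of \<open>D\<close> splits the first two block rows into scalar equations,
  so the eigenvector can be eliminated one coordinate at a time.\<close>

lemma sr_M_eigenvector_iff:
  fixes D :: "real^'n^'n"
  assumes D: "diagonal_matrix D"
  shows "sr_M D b *v v = \<mu> *\<^sub>R v \<longleftrightarrow>
    (\<forall>i. D $ i $ i * v $ Inl i - b $ i * v $ Inr (Inl i) = \<mu> * v $ Inl i) \<and>
    (\<forall>i. D $ i $ i * v $ Inr (Inl i) - b $ i * v $ Inr (Inr ()) = \<mu> * v $ Inr (Inl i)) \<and>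
    (\<Sum>i\<in>UNIV. v $ Inl i) = \<mu> * v $ Inr (Inr ())"
proof -
  have "(sr_M D b *v v) $ Inl i = D $ i $ i * v $ Inl i - b $ i * v $ Inr (Inl i)" for i
  proof -
    have "(\<Sum>j\<in>UNIV. D $ i $ j * v $ Inl j) = D $ i $ i * v $ Inl i"
      using diagonal_matrix_vector_mult_nth[OF D, of "\<chi> j. v $ Inl j" i]
      by (simp add: matrix_vector_mult_def)
    moreover have "(\<Sum>j\<in>UNIV. diag b $ i $ j * v $ Inr (Inl j)) = b $ i * v $ Inr (Inl i)"
      using diagonal_matrix_vector_mult_nth[of "diag b" "\<chi> j. v $ Inr (Inl j)" i]
      by (simp add: matrix_vector_mult_def diagonal_matrix_def diag_def)
    ultimately show ?thesis
      by (simp add: matrix_vector_mult_def sr_M_def sum_UNIV_Plus sum_negf)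
  qed
  moreover have "(sr_M D b *v v) $ Inr (Inl i) =
      D $ i $ i * v $ Inr (Inl i) - b $ i * v $ Inr (Inr ())" for i
  proof -
    have "(\<Sum>j\<in>UNIV. D $ i $ j * v $ Inr (Inl j)) = D $ i $ i * v $ Inr (Inl i)"
      using diagonal_matrix_vector_mult_nth[OF D, of "\<chi> j. v $ Inr (Inl j)" i]
      by (simp add: matrix_vector_mult_def)
    then show ?thesis
      by (simp add: matrix_vector_mult_def sr_M_def sum_UNIV_Plus UNIV_unit)
  qed
  moreover have "(sr_M D b *v v) $ Inr (Inr ()) = (\<Sum>i\<in>UNIV. v $ Inl i)"
    by (simp add: matrix_vector_mult_def sr_M_def sum_UNIV_Plus)
  moreover have "(\<forall>c. P c) \<longleftrightarrow> (\<forall>i. P (Inl i)) \<and> (\<forall>i. P (Inr (Inl i))) \<and> P (Inr (Inr ()))"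
    for P :: "'n + 'n + unit \<Rightarrow> bool"
    by (metis old.sum.exhaust old.unit.exhaust)
  ultimately show ?thesis
    by (simp add: vec_eq_iff)
qed

lemma sr_M_largest_real_eigenvalue:
  fixes D :: "real^'n^'n"
  assumes D: "diagonal_matrix D"
    and b: "\<And>i. b $ i = (D $ i $ i - y \<bullet> y) * y $ i"
    and le: "\<And>i. D $ i $ i \<le> y \<bullet> y"
  shows "is_largest_real_eigenvalue (sr_M D b) (y \<bullet> y)"
  unfolding is_largest_real_eigenvalue_def
proof (intro conjI allI impI)
  let ?v = "(\<chi> c. case c of Inl i \<Rightarrow> (y $ i)\<^sup>2 | Inr (Inl i) \<Rightarrow> y $ i | Inr (Inr _) \<Rightarrow> 1)
    :: real^('n + 'n + unit)"
  have "?v $ Inr (Inr ()) \<noteq> 0"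
    by simp
  then have "?v \<noteq> 0"
    by (metis zero_index)
  \<comment> \<open>The middle block row is the hypothesis \<open>b\<close>, the top one is
    \<open>b\<close> multiplied by \<open>y $ i\<close>, and the bottom one says that the squared
    entries of \<open>y\<close> sum to \<open>y \<bullet> y\<close>.\<close>
  moreover have "sr_M D b *v ?v = (y \<bullet> y) *\<^sub>R ?v"
    unfolding sr_M_eigenvector_iff[OF D]
    by (simp add: b power2_eq_square algebra_simps) (simp add: inner_vec_def)
  ultimately show "real_eigenvalue (sr_M D b) (y \<bullet> y)"
    unfolding real_eigenvalue_def by blast
next
  fix \<nu> assume "real_eigenvalue (sr_M D b) \<nu>"
  then obtain v where v: "v \<noteq> 0" and eig: "sr_M D b *v v = \<nu> *\<^sub>R v"
    unfolding real_eigenvalue_def by blast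
  let ?w = "v $ Inr (Inr ())"
  show "\<nu> \<le> y \<bullet> y"
  proof (rule ccontr)
    assume "\<not> \<nu> \<le> y \<bullet> y"
    then have lt: "0 < \<nu> - D $ i $ i" for i
      using le[of i] by linarith
    \<comment> \<open>This is the vector (\<nu> - D)^-1 b. The middle block row yields the second
      block of \<open>v\<close> from it, and substitution into the top row yields the first, both as
      multiples of \<open>?w\<close>.\<close>
    define r where "r i = b $ i / (\<nu> - D $ i $ i)" for i
    have v2: "v $ Inr (Inl i) = - r i * ?w" for i
    proof -
      have "(\<nu> - D $ i $ i) * v $ Inr (Inl i) = - b $ i * ?w"
        using eig unfolding sr_M_eigenvector_iff[OF D] by (simp add: algebra_simps)
      then show ?thesis
        using lt[of i] by (simp add: r_def field_simps)
    qed
    have v1: "v $ Inl i = (r i)\<^sup>2 * ?w" for i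
    proof -
      have "(\<nu> - D $ i $ i) * v $ Inl i = - b $ i * v $ Inr (Inl i)"
        using eig unfolding sr_M_eigenvector_iff[OF D] by (simp add: algebra_simps)
      then have "v $ Inl i = - r i * v $ Inr (Inl i)"
        using lt[of i] by (simp add: r_def field_simps)
      then show ?thesis
        by (simp add: v2 power2_eq_square)
    qed
    have "?w \<noteq> 0"
    proof
      assume w: "?w = 0"
      have "v $ c = 0" for c
        \<comment> \<open>The split on \<open>projr c\<close> separates the two summands nested
          under \<open>Inr\<close>.\<close>
        using v1 v2 w by (cases c rule: sum.exhaust; (cases "projr c" rule: sum.exhaust)?) auto
      then show False
        using v by (simp add: vec_eq_iff)
    qed
    moreover have "(\<Sum>i\<in>UNIV. (r i)\<^sup>2) * ?w = \<nu> * ?w"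
      using eig unfolding sr_M_eigenvector_iff[OF D] by (simp add: v1 sum_distrib_right)
    ultimately have "\<nu> = (\<Sum>i\<in>UNIV. (r i)\<^sup>2)"
      by simp
    also have "\<dots> \<le> (\<Sum>i\<in>UNIV. (y $ i)\<^sup>2)"
    proof (rule sum_mono)
      fix i
      \<comment> \<open>By \<open>b\<close>, r_i = -q y_i, and 0 \<le> q < 1 since D_ii \<le>
        \<open>y \<bullet> y\<close> < \<nu>.\<close>
      let ?q = "(y \<bullet> y - D $ i $ i) / (\<nu> - D $ i $ i)"
      have "\<bar>?q\<bar> \<le> 1"
        using le[of i] lt[of i] \<open>\<not> \<nu> \<le> y \<bullet> y\<close> by simp
      then have "?q\<^sup>2 \<le> 1"
        by (simp add: abs_square_le_1)
      moreover have "(r i)\<^sup>2 = ?q\<^sup>2 * (y $ i)\<^sup>2"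
        by (simp add: r_def b power_divide power_mult_distrib power2_commute)
      ultimately show "(r i)\<^sup>2 \<le> (y $ i)\<^sup>2"
        using mult_right_mono[of "?q\<^sup>2" 1 "(y $ i)\<^sup>2"] by simp
    qed
    also have "\<dots> = y \<bullet> y"
      by (simp add: inner_vec_def power2_eq_square)
    finally show False
      using \<open>\<not> \<nu> \<le> y \<bullet> y\<close> by simp
  qed
qed

section \<open>Expansion of the objective and change of basis\<close>

lemma sum_matrix_vector_mult:
  "(\<Sum>i\<in>I. B i) *v x = (\<Sum>i\<in>I. B i *v x)" for B :: "'i \<Rightarrow> real^'n^'k"
  by (induction I rule: infinite_finite_induct) (auto simp: matrix_vector_mult_add_rdistrib)

lemma uminus_matrix_vector_mult: "(- A) *v x = - (A *v x)" for A :: "real^'n^'k"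
  by (simp add: vec_eq_iff matrix_vector_mult_def sum_negf)

lemma outer_vector_mult: "outer u v *v x = (v \<bullet> x) *\<^sub>R u"
  by (simp add: vec_eq_iff outer_def matrix_vector_mult_def inner_vec_def sum_distrib_left mult_ac)

text \<open>Multiplying out the residuals, the total weight 1 normalizes the quartic term, the
  centering of the senders kills the cubic terms, and the symmetry of \<open>W\<close> merges terms
  that differ by exchanging \<open>i\<close> and \<open>j\<close>.\<close>

lemma sr_objective_eq:
  fixes W :: "real^'m^'m" and s :: "'m \<Rightarrow> real^'n"
  assumes sym: "symmetric_matrix W"
    and W1: "(\<Sum>i\<in>UNIV. \<Sum>j\<in>UNIV. W $ i $ j) = 1"
    and Ws: "(\<Sum>i\<in>UNIV. \<Sum>j\<in>UNIV. W $ i $ j *\<^sub>R s i) = 0"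
  shows "sr_objective W s d x =
    (x \<bullet> x)\<^sup>2 / 4 - x \<bullet> (sr_A W s d *v x) / 2 + sr_g W s d \<bullet> x + sr_objective W s d 0"
proof -
  define c where "c i = s i \<bullet> s i - (d i)\<^sup>2" for i
  define S where "S h = (\<Sum>i\<in>UNIV. \<Sum>j\<in>UNIV. W $ i $ j * h i j)" for h :: "'m \<Rightarrow> 'm \<Rightarrow> real"
  have S_add: "S (\<lambda>i j. h i j + k i j) = S h + S k" for h k
    by (simp add: S_def distrib_left sum.distrib)
  have S_mult: "S (\<lambda>i j. t * h i j) = t * S h" for t h
    by (simp add: S_def sum_distrib_left mult.left_commute)
  have S_swap: "S (\<lambda>i j. h j i) = S h" for h
  proof -
    have "W $ j $ i = W $ i $ j" for i j
      using sym by (simp add: symmetric_matrix_def vec_eq_iff transpose_def)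
    then show ?thesis
      unfolding S_def by (subst sum.swap) simp
  qed
  have S_one: "S (\<lambda>i j. 1) = 1"
    using W1 by (simp add: S_def)
  have "(\<Sum>i\<in>UNIV. \<Sum>j\<in>UNIV. W $ i $ j *\<^sub>R s i) \<bullet> x = 0"
    using Ws by simp
  then have S_s: "S (\<lambda>i j. s i \<bullet> x) = 0"
    by (simp add: S_def inner_sum_left)
  have "sr_A W s d *v x = - (\<Sum>i\<in>UNIV. \<Sum>j\<in>UNIV. W $ i $ j *\<^sub>R
      ((2 * (s i \<bullet> x)) *\<^sub>R s j + c i *\<^sub>R x))"
    by (simp add: sr_A_def c_def uminus_matrix_vector_mult sum_matrix_vector_mult
        outer_vector_mult matrix_vector_mult_add_rdistrib flip: scaleR_matrix_vector_assoc)
  then have A: "x \<bullet> (sr_A W s d *v x) = - S (\<lambda>i j. 2 * ((s i \<bullet> x) * (s j \<bullet> x)) + (x \<bullet> x) * c i)"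
    by (simp add: S_def inner_sum_right inner_add_right inner_commute mult_ac)
  have g: "sr_g W s d \<bullet> x = - S (\<lambda>i j. c i * (s j \<bullet> x))"
    by (simp add: sr_g_def S_def c_def inner_sum_left mult_ac)
  have dist: "(norm (x - s i))\<^sup>2 - (d i)\<^sup>2 = x \<bullet> x - 2 * (s i \<bullet> x) + c i" for i
    by (simp add: c_def power2_norm_eq_inner inner_simps inner_commute)
  \<comment> \<open>The summand is arranged as a sum of scalar multiples, with an explicit factor 1,
    so that the linearity rules \<open>S_add\<close> and \<open>S_mult\<close> take it
    apart.\<close>
  have "4 * sr_objective W s d x = S (\<lambda>i j. (x \<bullet> x)\<^sup>2 * 1
      + ((- 2 * (x \<bullet> x)) * (s i \<bullet> x) + ((- 2 * (x \<bullet> x)) * (s j \<bullet> x)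
      + ((x \<bullet> x) * c i + ((x \<bullet> x) * c j + (4 * ((s i \<bullet> x) * (s j \<bullet> x))
      + ((- 2) * (c i * (s j \<bullet> x)) + ((- 2) * (c j * (s i \<bullet> x)) + c i * c j))))))))"
    unfolding sr_objective_def dist S_def
    by (simp add: mult.assoc) (intro sum.cong refl, simp add: power2_eq_square algebra_simps)
  also have "\<dots> = (x \<bullet> x)\<^sup>2 + 2 * (x \<bullet> x) * S (\<lambda>i j. c i) + 4 * S (\<lambda>i j. (s i \<bullet> x) * (s j \<bullet> x))
      - 4 * S (\<lambda>i j. c i * (s j \<bullet> x)) + S (\<lambda>i j. c i * c j)"
    unfolding S_add S_mult
    using S_one S_s S_swap[of "\<lambda>i j. s i \<bullet> x"] S_swap[of "\<lambda>i j. c i"]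
      S_swap[of "\<lambda>i j. c i * (s j \<bullet> x)"]
    by simp
  finally have "4 * sr_objective W s d x = (x \<bullet> x)\<^sup>2 - 2 * (x \<bullet> (sr_A W s d *v x))
      + 4 * (sr_g W s d \<bullet> x) + S (\<lambda>i j. c i * c j)"
    unfolding A g S_add S_mult by simp
  moreover have "4 * sr_objective W s d 0 = S (\<lambda>i j. c i * c j)"
    by (simp add: sr_objective_def S_def c_def power2_norm_eq_inner mult.assoc)
  ultimately show ?thesis
    by simp
qed

theorem mainTheorem4:
  fixes W :: "real^'m^'m"
    and s :: "'m \<Rightarrow> real^'n::{finite,linorder}"
    and d :: "'m \<Rightarrow> real"
    and Q D :: "real^'n::{finite,linorder}^'n::{finite,linorder}"
    and b y :: "real^'n::{finite,linorder}"
    and f :: "real^'n::{finite,linorder} \<Rightarrow> real"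
  assumes "positive_definite W"
    and "(\<Sum>i\<in>UNIV. \<Sum>j\<in>UNIV. W $ i $ j) = 1"
    and "(\<Sum>i\<in>UNIV. \<Sum>j\<in>UNIV. W $ i $ j *\<^sub>R s i) = 0"
    and "orthogonal_matrix Q"
    and "D = transpose Q ** sr_A W s d ** Q"
    and "diagonal_matrix D"
    and "\<forall>i j. i \<le> j \<longrightarrow> D $ j $ j \<le> D $ i $ i"
    and "b = transpose Q *v sr_g W s d"
    and "f = (\<lambda>x. sr_objective W s d (Q *v x))"
    and "\<forall>z. f y \<le> f z"
  shows "is_largest_real_eigenvalue (sr_M D b) (y \<bullet> y)"
proof (rule sr_M_largest_real_eigenvalue)
  \<comment> \<open>Substituting \<open>Q *v z\<close> into the expansion preserves the quartic term
    by orthogonality and turns A into \<open>D\<close> and g into \<open>b\<close>. The constant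
    then cancels when values of \<open>f\<close> are compared.\<close>
  have f: "f z = (z \<bullet> z)\<^sup>2 / 4 - z \<bullet> (D *v z) / 2 + b \<bullet> z + sr_objective W s d 0" for z
  proof -
    have adj: "(Q *v z) \<bullet> w = z \<bullet> (transpose Q *v w)" for w
      by (metis dot_lmul_matrix vector_transpose_matrix)
    have "transpose Q *v (Q *v z) = z"
      using assms(4) by (simp only: matrix_vector_mul_assoc orthogonal_matrix matrix_vector_mul_lid)
    then have "(Q *v z) \<bullet> (Q *v z) = z \<bullet> z"
      by (simp only: adj)
    moreover have "(Q *v z) \<bullet> (sr_A W s d *v (Q *v z)) = z \<bullet> (D *v z)"
      unfolding assms(5) adj by (simp only: matrix_vector_mul_assoc matrix_mul_assoc)
    moreover have "sr_g W s d \<bullet> (Q *v z) = b \<bullet> z"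
      unfolding assms(8) by (simp only: inner_commute[of _ "Q *v z"] inner_commute[of _ z] adj)
    ultimately show ?thesis
      using sr_objective_eq[of W s d "Q *v z"] assms(1-3,9) by (simp add: positive_definite_def)
  qed
  have min: "(y \<bullet> y)\<^sup>2 / 4 - y \<bullet> (D *v y) / 2 + b \<bullet> y
      \<le> (z \<bullet> z)\<^sup>2 / 4 - z \<bullet> (D *v z) / 2 + b \<bullet> z" for z
    using assms(10) f[of y] f[of z] by (metis add_le_cancel_right)
  show "b $ i = (D $ i $ i - y \<bullet> y) * y $ i" "D $ i $ i \<le> y \<bullet> y" for i
    using quartic_minimizer[OF assms(6) min] by blast+
qed (use assms(6) in simp)

end
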